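(* Let $M$ be a compact metric space and $f:M\to M$ a continuous map. Then $\pi_{\mathbb{E}}(o(f))=h(f)$, where $h(f)$ is the topological entropy of $f$. Moreover, $o(f)\le\sup(\mathbb{E})$.
   Context: Orders of growth. Let $\mathbb{N}=\{1,2,\dots\}$ and let $\mathcal{O}$ be the set of non-decreasing sequences $a:\mathbb{N}\to[0,\infty)$. For $a_1,a_2\in\mathcal{O}$ write $a_1\approx a_2$ if there are $c,C\in(0,\infty)$ with $c\,a_1(n)\le a_2(n)\le C\,a_1(n)$ for all $n$. Let $\mathbb{O}=\mathcal{O}/{\approx}$, and let $[a(n)]\in\mathbb{O}$ denote the class of $a$. Partially order $\mathbb{O}$ by: $[a_1(n)]\le[a_2(n)]$ iff there is $C>0$ with $a_1(n)\le C\,a_2(n)$ for all $n$. Let $\overline{\mathbb{O}}$ be the Dedekind–MacNeille completion of $(\mathbb{O},\le)$ (the smallest complete lattice containing $\mathbb{O}$), so $\mathbb{O}\subset\overline{\mathbb{O}}$. Generalized topological entropy. For a compact metric space $(M,d)$ and a continuous map $f:M\to M$, put $d_n(x,y)=\max\{d(f^i(x),f^i(y)):0\le i\le n\}$ and $B(x,n,\epsilon)=\{y\in M:d_n(x,y)\le\epsilon\}$. Let $g_{f,\epsilon}(n)$ be the minimal cardinality of a finite set $E\subset M$ with $M=\bigcup_{x\in E}B(x,n,\epsilon)$. Then $g_{f,\epsilon}\in\mathcal{O}$, and $o(f)=\sup\{[g_{f,\epsilon}(n)]:\epsilon>0\}\in\overline{\mathbb{O}}$. The topological entropy is $h(f)=\lim_{\epsilon\to0}\limsup_{n\to\infty}\frac1n\log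 g_{f,\epsilon}(n)\in[0,\infty]$. Exponential orders of growth. $\mathbb{E}=\{[\exp(tn)]:t\in(0,\infty)\}\subset\mathbb{O}$, and $\sup(\mathbb{E})$ is taken in $\overline{\mathbb{O}}$. For $o\in\overline{\mathbb{O}}$ let $I_{\mathbb{E}}(o)=\{t\in(0,\infty):o\le[\exp(tn)]\}$. The map $\pi_{\mathbb{E}}:\overline{\mathbb{O}}\to[0,\infty]$ is defined by $\pi_{\mathbb{E}}(o)=\inf I_{\mathbb{E}}(o)$ if $I_{\mathbb{E}}(o)\ne\emptyset$, and $\pi_{\mathbb{E}}(o)=\infty$ if $I_{\mathbb{E}}(o)=\emptyset$. *)

theory Defs
  imports "HOL-Analysis.Analysis"
begin

section \<open>Orders of growth\<close>

text \<open>The index set is \<open>{1, 2, \<dots>}\<close>; sequences have type \<^typ>\<open>nat \<Rightarrow> real\<close>, but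
  their value at \<open>0\<close> is ignored by all notions below.\<close>

definition growth_sequences :: "(nat \<Rightarrow> real) set" where
  "growth_sequences = {a. (\<forall>n\<ge>1. 0 \<le> a n) \<and> mono_on {1..} a}"

definition growth_le :: "(nat \<Rightarrow> real) \<Rightarrow> (nat \<Rightarrow> real) \<Rightarrow> bool" where
  "growth_le a b \<longleftrightarrow> (\<exists>C>0. \<forall>n\<ge>1. a n \<le> C * b n)"

definition growth_equiv :: "(nat \<Rightarrow> real) \<Rightarrow> (nat \<Rightarrow> real) \<Rightarrow> bool" where
  "growth_equiv a b \<longleftrightarrow> a \<in> growth_sequences \<and> b \<in> growth_sequences \<and>
     (\<exists>c>0. \<exists>C>0. \<forall>n\<ge>1. c * a n \<le> b n \<and> b n \<le> C * a n)"

lemma growth_le_refl: "growth_le a a"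
  unfolding growth_le_def by (rule exI[of _ 1]) simp

lemma growth_le_trans:
  assumes "growth_le a b" "growth_le b c"
  shows "growth_le a c"
proof -
  obtain C D where C: "C > 0" "\<forall>n\<ge>1. a n \<le> C * b n"
    and D: "D > 0" "\<forall>n\<ge>1. b n \<le> D * c n"
    using assms unfolding growth_le_def by blast
  have "a n \<le> (C * D) * c n" if "n \<ge> 1" for n
  proof -
    have "a n \<le> C * b n" using C(2) that by blast
    also have "\<dots> \<le> C * (D * c n)" using C(1) D(2) that by (intro mult_left_mono) auto
    finally show ?thesis by (simp add: mult.assoc)
  qed
  then show ?thesis
    unfolding growth_le_def using C(1) D(1) by (intro exI[of _ "C * D"]) simp
qed

lemma growth_equiv_iff:
  "growth_equiv a b \<longleftrightarrow>
     a \<in> growth_sequences \<and> b \<in> growth_sequences \<and> growth_le a b \<and> growth_le b a"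
proof -
  have "(\<exists>c>0. \<forall>n\<ge>1. c * a n \<le> b n) \<longleftrightarrow> growth_le a b"
  proof
    assume "\<exists>c>0. \<forall>n\<ge>1. c * a n \<le> b n"
    then obtain c where "c > 0" "\<forall>n\<ge>1. c * a n \<le> b n" by blast
    then show "growth_le a b"
      unfolding growth_le_def by (intro exI[of _ "inverse c"]) (auto simp: field_simps)
  next
    assume "growth_le a b"
    then obtain C where "C > 0" "\<forall>n\<ge>1. a n \<le> C * b n" unfolding growth_le_def by blast
    then show "\<exists>c>0. \<forall>n\<ge>1. c * a n \<le> b n"
      by (intro exI[of _ "inverse C"]) (auto simp: field_simps)
  qed
  moreover have "(\<exists>C>0. \<forall>n\<ge>1. b n \<le> C * a n) \<longleftrightarrow> growth_le b a"
    unfolding growth_le_def by simp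
  ultimately show ?thesis unfolding growth_equiv_def by blast
qed

lemma part_equivp_growth_equiv: "part_equivp growth_equiv"
proof (rule part_equivpI)
  show "\<exists>a. growth_equiv a a"
    by (rule exI[of _ "\<lambda>_. 0"])
      (auto simp: growth_equiv_iff growth_le_refl growth_sequences_def mono_on_def)
  show "symp growth_equiv" by (auto simp: symp_def growth_equiv_iff)
  show "transp growth_equiv" by (auto simp: transp_def growth_equiv_iff intro: growth_le_trans)
qed

text \<open>The quotient is partial: \<^term>\<open>abs_growth a\<close> is the class of \<open>a\<close> for
  \<^prop>\<open>a \<in> growth_sequences\<close>, and is unspecified otherwise.\<close>

quotient_type growth = "nat \<Rightarrow> real" / partial: growth_equiv
  by (rule part_equivp_growth_equiv)

instantiation growth :: order
begin

lift_definition less_eq_growth :: "growth \<Rightarrow> growth \<Rightarrow> bool" is growth_le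
  unfolding growth_equiv_iff by (meson growth_le_trans)

definition less_growth :: "growth \<Rightarrow> growth \<Rightarrow> bool" where
  "less_growth x y \<longleftrightarrow> x \<le> y \<and> \<not> y \<le> x"

instance
proof
  fix x y z :: growth
  show "x < y \<longleftrightarrow> x \<le> y \<and> \<not> y \<le> x" by (rule less_growth_def)
  show "x \<le> x" by transfer (rule growth_le_refl)
  show "x \<le> y \<Longrightarrow> y \<le> z \<Longrightarrow> x \<le> z" by transfer (rule growth_le_trans)
  show "x \<le> y \<Longrightarrow> y \<le> x \<Longrightarrow> x = y" by transfer (simp add: growth_equiv_iff)
qed

end

lemma abs_growth_le_iff:
  assumes "a \<in> growth_sequences" "b \<in> growth_sequences"
  shows "abs_growth a \<le> abs_growth b \<longleftrightarrow> growth_le a b"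
  using assms by (simp add: less_eq_growth.abs_eq growth_equiv_iff growth_le_refl)

lemma abs_growth_eq_iff:
  assumes "a \<in> growth_sequences" "b \<in> growth_sequences"
  shows "abs_growth a = abs_growth b \<longleftrightarrow> growth_equiv a b"
  using assms abs_growth_le_iff by (auto simp: order_eq_iff growth_equiv_iff)


section \<open>The Dedekind--MacNeille completion\<close>

definition upper_bounds :: "'a::order set \<Rightarrow> 'a set" where
  "upper_bounds A = {u. \<forall>a\<in>A. a \<le> u}"

definition lower_bounds :: "'a::order set \<Rightarrow> 'a set" where
  "lower_bounds A = {l. \<forall>a\<in>A. l \<le> a}"

definition cut_closure :: "'a::order set \<Rightarrow> 'a set" where
  "cut_closure A = lower_bounds (upper_bounds A)"

lemma cut_closure_extensive: "A \<subseteq> cut_closure A"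
  by (auto simp: cut_closure_def lower_bounds_def upper_bounds_def)

lemma cut_closure_mono: "A \<subseteq> B \<Longrightarrow> cut_closure A \<subseteq> cut_closure B"
  unfolding cut_closure_def lower_bounds_def upper_bounds_def by blast

lemma cut_closure_idem [simp]: "cut_closure (cut_closure A) = cut_closure A"
  unfolding cut_closure_def lower_bounds_def upper_bounds_def by blast

lemma cut_closure_atMost [simp]: "cut_closure {..x} = {..x}"
  by (auto simp: cut_closure_def lower_bounds_def upper_bounds_def intro: order_trans)

typedef (overloaded) 'a macneille = "{A :: 'a::order set. cut_closure A = A}"
  morphisms lower_cut Abs_macneille
  by (rule exI[of _ "cut_closure {}"]) simp

setup_lifting type_definition_macneille

lemma cut_closure_lower_cut [simp]: "cut_closure (lower_cut x) = lower_cut x"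
  using lower_cut[of x] by simp

instantiation macneille :: (order) complete_lattice
begin

lift_definition less_eq_macneille :: "'a macneille \<Rightarrow> 'a macneille \<Rightarrow> bool" is "(\<subseteq>)" .

lift_definition less_macneille :: "'a macneille \<Rightarrow> 'a macneille \<Rightarrow> bool" is "(\<subset>)" .

lift_definition Inf_macneille :: "'a macneille set \<Rightarrow> 'a macneille" is "Inf"
proof -
  fix \<A> :: "'a set set"
  assume "\<And>A. A \<in> \<A> \<Longrightarrow> cut_closure A = A"
  then have "cut_closure (\<Inter>\<A>) \<subseteq> \<Inter>\<A>"
    using cut_closure_mono[of "\<Inter>\<A>"] by blast
  then show "cut_closure (\<Inter>\<A>) = \<Inter>\<A>"
    using cut_closure_extensive by blast
qed

lift_definition Sup_macneille :: "'a macneille set \<Rightarrow> 'a macneille" is "\<lambda>\<A>. cut_closure (\<Union>\<A>)"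
  by simp

lift_definition inf_macneille :: "'a macneille \<Rightarrow> 'a macneille \<Rightarrow> 'a macneille" is "(\<inter>)"
proof -
  fix A B :: "'a set"
  assume "cut_closure A = A" "cut_closure B = B"
  then show "cut_closure (A \<inter> B) = A \<inter> B"
    using cut_closure_mono[of "A \<inter> B"] cut_closure_extensive[of "A \<inter> B"] by blast
qed

lift_definition sup_macneille :: "'a macneille \<Rightarrow> 'a macneille \<Rightarrow> 'a macneille"
  is "\<lambda>A B. cut_closure (A \<union> B)"
  by simp

lift_definition bot_macneille :: "'a macneille" is "cut_closure {}"
  by simp

lift_definition top_macneille :: "'a macneille" is UNIV
  using cut_closure_extensive by blast

instance
proof
  fix x y z :: "'a macneille" and X :: "'a macneille set"
  show "x < y \<longleftrightarrow> x \<le> y \<and> \<not> y \<le> x" by transfer blast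
  show "x \<le> x" by transfer blast
  show "x \<le> y \<Longrightarrow> y \<le> z \<Longrightarrow> x \<le> z" by transfer blast
  show "x \<le> y \<Longrightarrow> y \<le> x \<Longrightarrow> x = y" by transfer blast
  show "inf x y \<le> x" "inf x y \<le> y" by (transfer, blast)+
  show "x \<le> y \<Longrightarrow> x \<le> z \<Longrightarrow> x \<le> inf y z" by transfer blast
  show "x \<le> sup x y" "y \<le> sup x y"
    using cut_closure_extensive[of "lower_cut x \<union> lower_cut y"]
    by (auto simp: less_eq_macneille.rep_eq sup_macneille.rep_eq)
  show "y \<le> x \<Longrightarrow> z \<le> x \<Longrightarrow> sup y z \<le> x"
    using cut_closure_mono[of "lower_cut y \<union> lower_cut z" "lower_cut x"]
    by (simp add: less_eq_macneille.rep_eq sup_macneille.rep_eq)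
  show "x \<in> X \<Longrightarrow> Inf X \<le> x" by transfer blast
  show "(\<And>y. y \<in> X \<Longrightarrow> x \<le> y) \<Longrightarrow> x \<le> Inf X" by transfer blast
  show "x \<in> X \<Longrightarrow> x \<le> Sup X"
    using cut_closure_extensive[of "\<Union>(lower_cut ` X)"]
    unfolding less_eq_macneille.rep_eq Sup_macneille.rep_eq by blast
  show "(\<And>y. y \<in> X \<Longrightarrow> y \<le> x) \<Longrightarrow> Sup X \<le> x"
    using cut_closure_mono[of "\<Union>(lower_cut ` X)" "lower_cut x"]
    unfolding less_eq_macneille.rep_eq Sup_macneille.rep_eq by (simp add: UN_least)
  show "Inf ({} :: 'a macneille set) = top" by transfer simp
  show "Sup ({} :: 'a macneille set) = bot" by transfer simp
qed

end

lift_definition principal_cut :: "'a::order \<Rightarrow> 'a macneille" is "\<lambda>x. {..x}"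
  by simp

lemma embed_le_iff [simp]: "principal_cut x \<le> principal_cut y \<longleftrightarrow> x \<le> y"
  by transfer auto

lemma principal_cut_le_iff_mem: "principal_cut a \<le> x \<longleftrightarrow> a \<in> lower_cut x"
proof -
  let ?A = "lower_cut x"
  have "{..a} \<subseteq> cut_closure ?A" if "a \<in> cut_closure ?A"
    using that unfolding cut_closure_def lower_bounds_def by (auto intro: order_trans)
  then show ?thesis
    unfolding less_eq_macneille.rep_eq principal_cut.rep_eq by auto
qed

lemma le_principal_cut_iff: "x \<le> principal_cut a \<longleftrightarrow> a \<in> upper_bounds (lower_cut x)"
  by (auto simp: less_eq_macneille.rep_eq principal_cut.rep_eq upper_bounds_def)

lemma macneille_leI:
  assumes "\<And>a. principal_cut a \<le> x \<Longrightarrow> principal_cut a \<le> y"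
  shows "x \<le> y"
  using assms unfolding principal_cut_le_iff_mem by (auto simp: less_eq_macneille.rep_eq)

text \<open>Join- and meet-density of the image of \<^const>\<open>principal_cut\<close> characterise the
  completion among the complete lattices containing the given order.\<close>

lemma macneille_eq_Sup: "x = Sup {principal_cut a | a. principal_cut a \<le> x}"
proof (rule antisym)
  show "Sup {principal_cut a | a. principal_cut a \<le> x} \<le> x" by (rule Sup_least) blast
  show "x \<le> Sup {principal_cut a | a. principal_cut a \<le> x}"
    by (rule macneille_leI, rule Sup_upper) blast
qed

lemma macneille_eq_Inf: "x = Inf {principal_cut a | a. x \<le> principal_cut a}"
proof (rule antisym)
  show "x \<le> Inf {principal_cut a | a. x \<le> principal_cut a}" by (rule Inf_greatest) blast
  show "Inf {principal_cut a | a. x \<le> principal_cut a} \<le> x"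
  proof (rule macneille_leI)
    fix b
    assume b: "principal_cut b \<le> Inf {principal_cut a | a. x \<le> principal_cut a}"
    have "b \<le> a" if "x \<le> principal_cut a" for a
    proof -
      have "Inf {principal_cut a | a. x \<le> principal_cut a} \<le> principal_cut a"
        using that by (intro Inf_lower) blast
      with b have "principal_cut b \<le> principal_cut a" by (rule order_trans)
      then show ?thesis by simp
    qed
    then have "b \<in> cut_closure (lower_cut x)"
      unfolding le_principal_cut_iff by (simp add: cut_closure_def lower_bounds_def)
    then show "principal_cut b \<le> x" by (simp add: principal_cut_le_iff_mem)
  qed
qed


section \<open>Generalized and classical topological entropy\<close>

definition dyn_dist :: "('a::metric_space \<Rightarrow> 'a) \<Rightarrow> nat \<Rightarrow> 'a \<Rightarrow> 'a \<Rightarrow> real" where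
  "dyn_dist f n x y = Max ((\<lambda>i. dist ((f ^^ i) x) ((f ^^ i) y)) ` {0..n})"

definition dyn_ball ::
  "'a::metric_space set \<Rightarrow> ('a \<Rightarrow> 'a) \<Rightarrow> 'a \<Rightarrow> nat \<Rightarrow> real \<Rightarrow> 'a set" where
  "dyn_ball M f x n \<epsilon> = {y \<in> M. dyn_dist f n x y \<le> \<epsilon>}"

definition span_number :: "'a::metric_space set \<Rightarrow> ('a \<Rightarrow> 'a) \<Rightarrow> real \<Rightarrow> nat \<Rightarrow> nat" where
  "span_number M f \<epsilon> n =
     (LEAST k. \<exists>E. finite E \<and> E \<subseteq> M \<and> M = (\<Union>x\<in>E. dyn_ball M f x n \<epsilon>) \<and> card E = k)"

definition gen_entropy :: "'a::metric_space set \<Rightarrow> ('a \<Rightarrow> 'a) \<Rightarrow> growth macneille" where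
  "gen_entropy M f = Sup {principal_cut (abs_growth (\<lambda>n. real (span_number M f \<epsilon> n))) | \<epsilon>. \<epsilon> > 0}"

definition topological_entropy :: "'a::metric_space set \<Rightarrow> ('a \<Rightarrow> 'a) \<Rightarrow> ereal" where
  "topological_entropy M f =
     Lim (at_right 0)
       (\<lambda>\<epsilon>. limsup (\<lambda>n. ereal (1 / real n * ln (real (span_number M f \<epsilon> n)))))"


section \<open>Exponential orders of growth\<close>

definition exp_growth :: "real \<Rightarrow> growth" where
  "exp_growth t = abs_growth (\<lambda>n. exp (t * real n))"

definition exp_orders :: "growth set" where
  "exp_orders = {exp_growth t | t. t > 0}"

definition exp_indices :: "growth macneille \<Rightarrow> real set" where
  "exp_indices u = {t. t > 0 \<and> u \<le> principal_cut (exp_growth t)}"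

definition exp_projection :: "growth macneille \<Rightarrow> ereal" where
  "exp_projection u = (if exp_indices u = {} then \<infinity> else Inf (ereal ` exp_indices u))"

lemma exp_growth_sequence:
  assumes "t > 0"
  shows "(\<lambda>n. exp (t * real n)) \<in> growth_sequences"
  using assms by (auto simp: growth_sequences_def mono_on_def)


section \<open>Well-definedness\<close>

lemma dyn_dist_le_iff:
  "dyn_dist f n x y \<le> e \<longleftrightarrow> (\<forall>i\<le>n. dist ((f ^^ i) x) ((f ^^ i) y) \<le> e)"
  by (auto simp: dyn_dist_def)

lemma funpow_invariant:
  assumes "f ` M \<subseteq> M" "x \<in> M"
  shows "(f ^^ i) x \<in> M"
  using assms by (induction i) auto

lemma continuous_on_funpow:
  assumes "continuous_on M f" "f ` M \<subseteq> M"
  shows "continuous_on M (f ^^ i)"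
proof (induction i)
  case 0
  then show ?case by (simp add: continuous_on_id' id_def)
next
  case (Suc i)
  have "continuous_on ((f ^^ i) ` M) f"
    using assms(2) by (intro continuous_on_subset[OF assms(1)]) (auto intro: funpow_invariant)
  then show ?case using continuous_on_compose[OF Suc] by simp
qed

lemma finite_spanning_set:
  fixes M :: "'a::metric_space set"
  assumes "compact M" "continuous_on M f" "f ` M \<subseteq> M" "\<epsilon> > 0"
  shows "\<exists>E. finite E \<and> E \<subseteq> M \<and> M = (\<Union>x\<in>E. dyn_ball M f x n \<epsilon>)"
proof -
  have uc: "\<exists>\<delta>>0. \<forall>x\<in>M. \<forall>y\<in>M. dist x y < \<delta> \<longrightarrow> dist ((f ^^ i) x) ((f ^^ i) y) \<le> \<epsilon>" for i
  proof -
    have "uniformly_continuous_on M (f ^^ i)"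
      using assms(1) continuous_on_funpow[OF assms(2,3)] by (rule compact_uniformly_continuous[rotated])
    then show ?thesis
      using assms(4) unfolding uniformly_continuous_on_def by (metis dist_commute less_imp_le)
  qed
  then obtain \<delta> where \<delta>: "\<And>i. \<delta> i > 0"
    "\<And>i x y. \<lbrakk>x \<in> M; y \<in> M; dist x y < \<delta> i\<rbrakk> \<Longrightarrow> dist ((f ^^ i) x) ((f ^^ i) y) \<le> \<epsilon>"
    by metis
  define r where "r = Min (\<delta> ` {0..n})"
  have "r > 0" using \<delta>(1) by (simp add: r_def)
  then obtain E where E: "finite E" "E \<subseteq> M" "M \<subseteq> (\<Union>x\<in>E. ball x r)"
    using assms(1) compact_imp_seq_compact seq_compact_imp_totally_bounded by metis
  have "M \<subseteq> (\<Union>x\<in>E. dyn_ball M f x n \<epsilon>)"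
  proof
    fix y assume "y \<in> M"
    then obtain x where x: "x \<in> E" "dist x y < r" using E(3) by auto
    have "dist ((f ^^ i) x) ((f ^^ i) y) \<le> \<epsilon>" if "i \<le> n" for i
    proof -
      have "r \<le> \<delta> i" using that by (simp add: r_def)
      then show ?thesis using \<delta>(2)[of x y i] x E(2) \<open>y \<in> M\<close> by auto
    qed
    then show "y \<in> (\<Union>x\<in>E. dyn_ball M f x n \<epsilon>)"
      using x \<open>y \<in> M\<close> by (auto simp: dyn_ball_def dyn_dist_le_iff)
  qed
  then have "M = (\<Union>x\<in>E. dyn_ball M f x n \<epsilon>)" by (auto simp: dyn_ball_def)
  with E(1,2) show ?thesis by (intro exI[of _ E] conjI)
qed

lemma span_number_le:
  assumes "finite E" "E \<subseteq> M" "M = (\<Union>x\<in>E. dyn_ball M f x n \<epsilon>)"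
  shows "span_number M f \<epsilon> n \<le> card E"
  unfolding span_number_def by (rule Least_le) (intro exI[of _ E] conjI assms refl)

lemma span_number_attained:
  assumes "compact M" "continuous_on M f" "f ` M \<subseteq> M" "\<epsilon> > 0"
  obtains E where "finite E" "E \<subseteq> M" "M = (\<Union>x\<in>E. dyn_ball M f x n \<epsilon>)"
    "card E = span_number M f \<epsilon> n"
proof -
  have "\<exists>k E. finite E \<and> E \<subseteq> M \<and> M = (\<Union>x\<in>E. dyn_ball M f x n \<epsilon>) \<and> card E = k"
    using finite_spanning_set[OF assms] by metis
  from LeastI_ex[OF this] show ?thesis
    unfolding span_number_def[symmetric] by (elim exE conjE) (rule that)
qed

lemma span_number_mono:
  assumes "compact M" "continuous_on M f" "f ` M \<subseteq> M" "0 < \<epsilon>" "\<epsilon> \<le> \<epsilon>'" "m \<le> n"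
  shows "span_number M f \<epsilon>' m \<le> span_number M f \<epsilon> n"
proof -
  obtain E where E: "finite E" "E \<subseteq> M" "M = (\<Union>x\<in>E. dyn_ball M f x n \<epsilon>)"
    "card E = span_number M f \<epsilon> n"
    using span_number_attained[OF assms(1-4)] by blast
  have "dyn_ball M f x n \<epsilon> \<subseteq> dyn_ball M f x m \<epsilon>'" for x
    using assms(5,6) unfolding dyn_ball_def dyn_dist_le_iff by (blast intro: order_trans)
  then have "(\<Union>x\<in>E. dyn_ball M f x n \<epsilon>) \<subseteq> (\<Union>x\<in>E. dyn_ball M f x m \<epsilon>')" by blast
  then have "M \<subseteq> (\<Union>x\<in>E. dyn_ball M f x m \<epsilon>')" by (rule subset_trans[OF equalityD1[OF E(3)]])
  moreover have "(\<Union>x\<in>E. dyn_ball M f x m \<epsilon>') \<subseteq> M" by (auto simp: dyn_ball_def)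
  ultimately have "M = (\<Union>x\<in>E. dyn_ball M f x m \<epsilon>')" by (rule equalityI)
  from span_number_le[OF E(1,2) this] show ?thesis unfolding E(4) .
qed

lemma span_number_growth_sequence:
  assumes "compact M" "continuous_on M f" "f ` M \<subseteq> M" "\<epsilon> > 0"
  shows "(\<lambda>n. real (span_number M f \<epsilon> n)) \<in> growth_sequences"
  using span_number_mono[OF assms order_refl] by (simp add: growth_sequences_def mono_on_def)

lemma topological_entropy_tendsto:
  assumes "compact M" "continuous_on M f" "f ` M \<subseteq> M"
  shows "((\<lambda>\<epsilon>. limsup (\<lambda>n. ereal (1 / real n * ln (real (span_number M f \<epsilon> n)))))
    \<longlongrightarrow> topological_entropy M f) (at_right 0)"
proof -
  define h :: "real \<Rightarrow> ereal" where "h = (\<lambda>\<epsilon>. limsup (\<lambda>n. ereal (1 / real n * ln (real (span_number M f \<epsilon> n)))))"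
  have ln_mono_nat: "ln (real k) \<le> ln (real l)" if "k \<le> l" for k l :: nat
    using that by (cases "k = 0"; cases "l = 0") auto
  have anti: "h \<epsilon>' \<le> h \<epsilon>" if "0 < \<epsilon>" "\<epsilon> \<le> \<epsilon>'" for \<epsilon> \<epsilon>'
    unfolding h_def
  proof (intro Limsup_mono always_eventually allI)
    fix n
    show "ereal (1 / real n * ln (real (span_number M f \<epsilon>' n)))
      \<le> ereal (1 / real n * ln (real (span_number M f \<epsilon> n)))"
      using ln_mono_nat[OF span_number_mono[OF assms that order_refl]]
      by (simp add: divide_right_mono)
  qed
  have lim: "(h \<longlongrightarrow> (SUP \<epsilon>\<in>{0<..}. h \<epsilon>)) (at_right 0)"
  proof (rule order_tendstoI)
    fix a assume "a < (SUP \<epsilon>\<in>{0<..}. h \<epsilon>)"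
    then obtain \<epsilon> where \<epsilon>: "\<epsilon> > 0" "a < h \<epsilon>" by (auto simp: less_SUP_iff)
    show "\<forall>\<^sub>F x in at_right 0. a < h x"
      unfolding eventually_at_right_field
      using \<epsilon> anti by (intro exI[of _ \<epsilon>]) (auto intro: less_le_trans)
  next
    fix a assume a: "(SUP \<epsilon>\<in>{0<..}. h \<epsilon>) < a"
    have "h x < a" if "x > 0" for x
      using that by (intro le_less_trans[OF SUP_upper a]) auto
    then show "\<forall>\<^sub>F x in at_right 0. h x < a"
      unfolding eventually_at_right_field by (intro exI[of _ 1]) auto
  qed
  then have "Lim (at_right 0) h = (SUP \<epsilon>\<in>{0<..}. h \<epsilon>)"
    by (intro tendsto_Lim) auto
  with lim show ?thesis by (simp add: topological_entropy_def h_def)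
qed

end

theory Submission imports Defs begin

text \<open>
  For one growth sequence \<open>a\<close> put \<open>\<rho> = limsup (1/n) ln (a n)\<close>. Comparing \<open>a\<close> with the family
  \<open>exp (t n)\<close>, \<open>t > 0\<close>, recovers \<open>\<rho>\<close>: if \<open>\<rho> < t\<close> then \<open>a n \<le> exp (t n)\<close> from some index on, and
  monotonicity bounds the finitely many earlier terms by a constant; conversely a bound
  \<open>a n \<le> C exp (t n)\<close> gives \<open>\<rho> \<le> t\<close>, because \<open>ln C / n\<close> vanishes in the limit. These two facts are
  \<open>growth_le_exp_if_rate_less\<close> and \<open>exp_rate_le_if_growth_le_exp\<close>.

  Both \<open>gen_entropy\<close> and \<open>topological_entropy\<close> are suprema over the scale \<open>\<epsilon>\<close>: the former by
  definition, the latter because the rate of the spanning numbers grows as \<open>\<epsilon>\<close> decreases, so that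
  its limit at \<open>0\<close> is its least upper bound. An upper bound \<open>t\<close> can therefore be tested scale by
  scale on either side, and the comparison above transfers to the suprema. The borderline \<open>\<rho> = t\<close>,
  where the two facts leave a gap, is lost when the infimum over \<open>t\<close> is taken.

  The bound by the supremum of the exponential orders holds even though the entropy may be
  infinite: at each fixed scale the spanning numbers lie below a single exponential order, only
  the exponent may grow without bound as \<open>\<epsilon>\<close> decreases. If \<open>M\<close> is covered by \<open>N\<close> balls of radius
  \<open>\<epsilon>/2\<close>, two points that visit the same balls at the times \<open>0, \<dots>, n\<close> are \<open>\<epsilon>\<close>-close up to time
  \<open>n\<close>, and there are at most \<open>N ^ (n + 1)\<close> such itineraries (\<open>span_number_le_power\<close>).
\<close>

section \<open>Exponential rate of a growth sequence\<close>

definition exp_rate :: "(nat \<Rightarrow> real) \<Rightarrow> ereal" where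
  "exp_rate a = limsup (\<lambda>n. ereal (1 / real n * ln (a n)))"

lemma growth_le_exp_if_rate_less:
  assumes a: "a \<in> growth_sequences" and t: "0 < t" and less: "exp_rate a < ereal t"
  shows "growth_le a (\<lambda>n. exp (t * real n))"
proof -
  have "\<forall>\<^sub>F n in sequentially. ereal (1 / real n * ln (a n)) < ereal t"
    using less unfolding exp_rate_def by (rule Limsup_lessD)
  then obtain N where N: "\<And>n. n \<ge> N \<Longrightarrow> 1 / real n * ln (a n) < t"
    unfolding eventually_sequentially by auto
  have nonneg: "0 \<le> a n" if "n \<ge> 1" for n
    using a that by (simp add: growth_sequences_def)
  have mono: "a m \<le> a n" if "1 \<le> m" "m \<le> n" for m n
    using a that by (auto simp: growth_sequences_def mono_on_def)
  define C where "C = 1 + a (N + 1)"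
  have C: "C \<ge> 1" using nonneg[of "N + 1"] by (simp add: C_def)
  have "a n \<le> C * exp (t * real n)" if n: "n \<ge> 1" for n
  proof (cases "n \<le> N")
    case True
    have "a n \<le> C * 1" using mono[of n "N + 1"] n True by (simp add: C_def)
    also have "\<dots> \<le> C * exp (t * real n)" using C t by (intro mult_left_mono) auto
    finally show ?thesis .
  next
    case False
    have "a n \<le> exp (t * real n)"
    proof (cases "a n = 0")
      case False
      then have pos: "a n > 0" using nonneg[OF n] by simp
      have "ln (a n) < t * real n"
        using N[of n] \<open>\<not> n \<le> N\<close> n by (simp add: field_simps)
      then have "exp (ln (a n)) < exp (t * real n)" by simp
      then show ?thesis using pos by simp
    qed simp
    also have "\<dots> \<le> C * exp (t * real n)" using C by simp
    finally show ?thesis .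
  qed
  then show ?thesis
    unfolding growth_le_def using C by (intro exI[of _ C]) auto
qed

lemma exp_rate_le_if_growth_le_exp:
  assumes a: "a \<in> growth_sequences" and t: "0 < t"
    and le: "growth_le a (\<lambda>n. exp (t * real n))"
  shows "exp_rate a \<le> ereal t"
proof -
  obtain C where C: "C > 0" "\<And>n. n \<ge> 1 \<Longrightarrow> a n \<le> C * exp (t * real n)"
    using le unfolding growth_le_def by blast
  \<comment> \<open>A constant that is at least \<open>1\<close> also covers the terms with \<open>a n = 0\<close>, where \<open>ln (a n) = 0\<close>.\<close>
  define D where "D = max C 1"
  have D: "D \<ge> 1" "C \<le> D" by (auto simp: D_def)
  have bound: "1 / real n * ln (a n) \<le> ln D / real n + t" if n: "n \<ge> 1" for n
  proof -
    have "ln (a n) \<le> ln D + t * real n"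
    proof (cases "a n = 0")
      case True
      then show ?thesis using D t by simp
    next
      case False
      moreover have "0 \<le> a n" using a n by (simp add: growth_sequences_def)
      ultimately have pos: "a n > 0" by simp
      have "a n \<le> C * exp (t * real n)" using C(2)[OF n] .
      also have "\<dots> \<le> D * exp (t * real n)" using D by (intro mult_right_mono) auto
      finally have "ln (a n) \<le> ln (D * exp (t * real n))"
        using pos D by (intro ln_mono) auto
      also have "\<dots> = ln D + t * real n" using D by (subst ln_mult) auto
      finally show ?thesis .
    qed
    then show ?thesis using n by (simp add: field_simps)
  qed
  have "((\<lambda>n. ln D / real n + t) \<longlonglongrightarrow> 0 + t)"
    by (intro tendsto_add tendsto_const real_tendsto_divide_at_top[OF tendsto_const]
      filterlim_real_sequentially)
  then have lim: "limsup (\<lambda>n. ereal (ln D / real n + t)) = ereal t"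
    by (intro lim_imp_Limsup) auto
  have "exp_rate a \<le> limsup (\<lambda>n. ereal (ln D / real n + t))"
    unfolding exp_rate_def
    by (intro Limsup_mono eventually_sequentiallyI[of 1]) (use bound in auto)
  then show ?thesis by (simp add: lim)
qed


section \<open>Testing both entropies scale by scale\<close>

lemma gen_entropy_le_iff:
  "gen_entropy M f \<le> u \<longleftrightarrow>
     (\<forall>\<epsilon>>0. principal_cut (abs_growth (\<lambda>n. real (span_number M f \<epsilon> n))) \<le> u)"
  unfolding gen_entropy_def by (auto simp: Sup_le_iff)

lemma gen_entropy_le_exp_growth_iff:
  assumes "compact M" "continuous_on M f" "f ` M \<subseteq> M" "0 < t"
  shows "gen_entropy M f \<le> principal_cut (exp_growth t) \<longleftrightarrow>
     (\<forall>\<epsilon>>0. growth_le (\<lambda>n. real (span_number M f \<epsilon> n)) (\<lambda>n. exp (t * real n)))"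
  unfolding gen_entropy_le_iff exp_growth_def
  using span_number_growth_sequence[OF assms(1-3)] exp_growth_sequence[OF assms(4)]
  by (simp add: abs_growth_le_iff)

lemma exp_rate_nat_mono:
  assumes "\<And>n. u n \<le> v n"
  shows "exp_rate (\<lambda>n. real (u n)) \<le> exp_rate (\<lambda>n. real (v n))"
  unfolding exp_rate_def
proof (intro Limsup_mono always_eventually allI)
  fix n
  have "ln (real (u n)) \<le> ln (real (v n))"
    using assms[of n] by (cases "u n = 0"; cases "v n = 0") auto
  then show "ereal (1 / real n * ln (real (u n))) \<le> ereal (1 / real n * ln (real (v n)))"
    by (simp add: divide_right_mono)
qed

lemma topological_entropy_le_iff:
  assumes "compact M" "continuous_on M f" "f ` M \<subseteq> M"
  shows "topological_entropy M f \<le> c \<longleftrightarrow>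
     (\<forall>\<epsilon>>0. exp_rate (\<lambda>n. real (span_number M f \<epsilon> n)) \<le> c)"
proof -
  define h where "h = (\<lambda>\<epsilon>. exp_rate (\<lambda>n. real (span_number M f \<epsilon> n)))"
  have lim: "(h \<longlongrightarrow> topological_entropy M f) (at_right 0)"
    using topological_entropy_tendsto[OF assms] by (simp add: h_def exp_rate_def)
  have anti: "h \<epsilon>' \<le> h \<epsilon>" if "0 < \<epsilon>" "\<epsilon> \<le> \<epsilon>'" for \<epsilon> \<epsilon>'
    unfolding h_def using span_number_mono[OF assms that order_refl] by (rule exp_rate_nat_mono)
  have "h \<epsilon> \<le> topological_entropy M f" if "\<epsilon> > 0" for \<epsilon>
  proof (rule tendsto_lowerbound[OF lim])
    show "\<forall>\<^sub>F x in at_right 0. h \<epsilon> \<le> h x"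
      unfolding eventually_at_right_field
      using that anti by (intro exI[of _ \<epsilon>]) auto
  qed simp
  moreover have "topological_entropy M f \<le> c" if "\<forall>\<epsilon>>0. h \<epsilon> \<le> c"
  proof (rule tendsto_upperbound[OF lim])
    show "\<forall>\<^sub>F x in at_right 0. h x \<le> c"
      unfolding eventually_at_right_field using that by (intro exI[of _ 1]) auto
  qed simp
  ultimately show ?thesis unfolding h_def by (blast intro: order_trans)
qed

lemma topological_entropy_nonneg:
  assumes "compact M" "continuous_on M f" "f ` M \<subseteq> M"
  shows "0 \<le> topological_entropy M f"
proof -
  have "0 = exp_rate (\<lambda>n. real 0)" by (simp add: exp_rate_def Limsup_const zero_ereal_def)
  also have "\<dots> \<le> exp_rate (\<lambda>n. real (span_number M f 1 n))" by (rule exp_rate_nat_mono) simp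
  also have "\<dots> \<le> topological_entropy M f"
    using topological_entropy_le_iff[OF assms, of "topological_entropy M f"] by simp
  finally show ?thesis .
qed


section \<open>Spanning numbers grow at most exponentially\<close>

text \<open>One representative per itinerary spans: points with a common itinerary stay within
  \<open>\<epsilon>/2 + \<epsilon>/2\<close> of each other up to time \<open>n\<close>, and an itinerary is a word of length \<open>n + 1\<close> over \<open>E\<close>.\<close>

lemma span_number_le_power:
  assumes inv: "f ` M \<subseteq> M" and E: "finite E" "M \<subseteq> (\<Union>x\<in>E. ball x (\<epsilon> / 2))"
  shows "span_number M f \<epsilon> n \<le> card E ^ Suc n"
proof -
  have "\<forall>y\<in>M. \<exists>x\<in>E. dist x y < \<epsilon> / 2"
    using E(2) unfolding subset_iff UN_iff mem_ball by blast
  then obtain c where c: "\<And>y. y \<in> M \<Longrightarrow> c y \<in> E" "\<And>y. y \<in> M \<Longrightarrow> dist (c y) y < \<epsilon> / 2"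
    by metis
  define itin where "itin y = restrict (\<lambda>i. c ((f ^^ i) y)) {0..n}" for y
  define F where "F = inv_into M itin ` itin ` M"
  have sub: "itin ` M \<subseteq> (\<Pi>\<^sub>E i\<in>{0..n}. E)"
    using c(1) funpow_invariant[OF inv] by (auto simp: itin_def)
  have finW: "finite (\<Pi>\<^sub>E i\<in>{0..n}. E)" using E(1) by (intro finite_PiE) auto
  have fin: "finite (itin ` M)" using finite_subset[OF sub finW] .
  have FM: "F \<subseteq> M" unfolding F_def by (auto intro: inv_into_into)
  have "M \<subseteq> (\<Union>x\<in>F. dyn_ball M f x n \<epsilon>)"
  proof
    fix y assume y: "y \<in> M"
    define x where "x = inv_into M itin (itin y)"
    have x: "x \<in> F" "itin x = itin y"
      using y by (auto simp: F_def x_def f_inv_into_f)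
    have "dist ((f ^^ i) x) ((f ^^ i) y) \<le> \<epsilon>" if i: "i \<le> n" for i
    proof -
      have mem: "(f ^^ i) x \<in> M" "(f ^^ i) y \<in> M"
        using x(1) FM y funpow_invariant[OF inv] by auto
      have "c ((f ^^ i) x) = c ((f ^^ i) y)"
        using fun_cong[OF x(2), of i] i by (simp add: itin_def)
      then have "dist (c ((f ^^ i) x)) ((f ^^ i) x) < \<epsilon> / 2"
        "dist (c ((f ^^ i) x)) ((f ^^ i) y) < \<epsilon> / 2"
        using c(2)[OF mem(1)] c(2)[OF mem(2)] by auto
      then show ?thesis
        using dist_triangle3[of "(f ^^ i) x" "(f ^^ i) y" "c ((f ^^ i) x)"] by linarith
    qed
    then show "y \<in> (\<Union>x\<in>F. dyn_ball M f x n \<epsilon>)"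
      using x(1) y by (auto simp: dyn_ball_def dyn_dist_le_iff)
  qed
  then have "M = (\<Union>x\<in>F. dyn_ball M f x n \<epsilon>)" by (auto simp: dyn_ball_def)
  moreover have "finite F" unfolding F_def using fin by simp
  ultimately have "span_number M f \<epsilon> n \<le> card F" using FM by (intro span_number_le)
  also have "\<dots> \<le> card (itin ` M)" unfolding F_def using fin by (rule card_image_le)
  also have "\<dots> \<le> card (\<Pi>\<^sub>E i\<in>{0..n}. E)" using finW sub by (rule card_mono)
  also have "\<dots> = card E ^ Suc n" by (simp add: card_PiE)
  finally show ?thesis .
qed

lemma span_number_growth_le_exp:
  assumes "compact M" "f ` M \<subseteq> M" "\<epsilon> > 0"
  shows "\<exists>t>0. growth_le (\<lambda>n. real (span_number M f \<epsilon> n)) (\<lambda>n. exp (t * real n))"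
proof -
  obtain E where E: "finite E" "M \<subseteq> (\<Union>x\<in>E. ball x (\<epsilon> / 2))"
    using seq_compact_imp_totally_bounded[OF compact_imp_seq_compact[OF assms(1)]] half_gt_zero[OF assms(3)]
    by blast
  \<comment> \<open>The crude estimate \<open>t \<le> exp t\<close> turns the base of the power into an exponent; adding \<open>1\<close> keeps
    it positive when \<open>E\<close> is empty.\<close>
  define t where "t = real (card E) + 1"
  have t: "t > 0" "real (card E) \<le> t" by (auto simp: t_def)
  have base: "t \<le> exp t" using exp_ge_add_one_self[of t] by linarith
  have "real (span_number M f \<epsilon> n) \<le> t * exp (t * real n)" for n
  proof -
    have "real (span_number M f \<epsilon> n) \<le> real (card E) ^ Suc n"
      using span_number_le_power[OF assms(2) E, of n] by (metis of_nat_le_iff of_nat_power)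
    also have "\<dots> \<le> t ^ Suc n" using t by (intro power_mono) auto
    also have "\<dots> = t * t ^ n" by simp
    also have "\<dots> \<le> t * exp t ^ n" using t base by (intro mult_left_mono power_mono) auto
    also have "\<dots> = t * exp (t * real n)"
      using exp_of_nat_mult[of n t] by (simp add: mult.commute)
    finally show ?thesis .
  qed
  then show ?thesis unfolding growth_le_def using t(1) by blast
qed


section \<open>The exponential projection of the generalized entropy\<close>

theorem theorem2:
  fixes M :: "'a::metric_space set" and f :: "'a \<Rightarrow> 'a"
  assumes "compact M" and "continuous_on M f" and "f ` M \<subseteq> M"
  shows "exp_projection (gen_entropy M f) = topological_entropy M f
    \<and> gen_entropy M f \<le> Sup (principal_cut ` exp_orders)"
proof
  let ?g = "\<lambda>\<epsilon> n. real (span_number M f \<epsilon> n)"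
  let ?h = "topological_entropy M f"
  note seq = span_number_growth_sequence[OF assms]
  \<comment> \<open>Since \<open>Inf {} = \<infinity>\<close> in the extended reals, the case distinction in the projection collapses.\<close>
  have proj: "exp_projection (gen_entropy M f) = Inf (ereal ` exp_indices (gen_entropy M f))"
    by (simp add: exp_projection_def top_ereal_def)
  show "exp_projection (gen_entropy M f) = ?h"
    unfolding proj
  proof (rule antisym)
    show "?h \<le> Inf (ereal ` exp_indices (gen_entropy M f))"
    proof (rule Inf_greatest)
      fix s assume "s \<in> ereal ` exp_indices (gen_entropy M f)"
      then obtain t where t: "s = ereal t" "t > 0" "gen_entropy M f \<le> principal_cut (exp_growth t)"
        by (auto simp: exp_indices_def)
      then have "growth_le (?g \<epsilon>) (\<lambda>n. exp (t * real n))" if "\<epsilon> > 0" for \<epsilon>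
        using gen_entropy_le_exp_growth_iff[OF assms t(2)] that by simp
      then show "?h \<le> s"
        unfolding topological_entropy_le_iff[OF assms] t(1)
        using exp_rate_le_if_growth_le_exp[OF seq t(2)] by blast
    qed
  next
    show "Inf (ereal ` exp_indices (gen_entropy M f)) \<le> ?h"
    proof (rule dense_ge)
      fix s assume "?h < s"
      then obtain t where t: "?h < ereal t" "ereal t < s"
        using ereal_dense2 by blast
      have pos: "t > 0" using le_less_trans[OF topological_entropy_nonneg[OF assms] t(1)] by simp
      have "exp_rate (?g \<epsilon>) < ereal t" if "\<epsilon> > 0" for \<epsilon>
        using topological_entropy_le_iff[OF assms, of ?h] that t(1) by (auto intro: le_less_trans)
      then have "\<forall>\<epsilon>>0. growth_le (?g \<epsilon>) (\<lambda>n. exp (t * real n))"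
        using growth_le_exp_if_rate_less[OF seq pos] by blast
      then have "t \<in> exp_indices (gen_entropy M f)"
        using pos gen_entropy_le_exp_growth_iff[OF assms pos] by (simp add: exp_indices_def)
      then have "Inf (ereal ` exp_indices (gen_entropy M f)) \<le> ereal t"
        by (intro Inf_lower imageI)
      then show "Inf (ereal ` exp_indices (gen_entropy M f)) \<le> s" using t(2) by simp
    qed
  qed
next
  show "gen_entropy M f \<le> Sup (principal_cut ` exp_orders)"
    unfolding gen_entropy_le_iff
  proof (intro allI impI)
    fix \<epsilon> :: real assume \<epsilon>: "\<epsilon> > 0"
    obtain t where t: "t > 0" "growth_le (\<lambda>n. real (span_number M f \<epsilon> n)) (\<lambda>n. exp (t * real n))"
      using span_number_growth_le_exp[OF assms(1,3) \<epsilon>] by blast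
    have "principal_cut (abs_growth (\<lambda>n. real (span_number M f \<epsilon> n))) \<le> principal_cut (exp_growth t)"
      using t span_number_growth_sequence[OF assms \<epsilon>] exp_growth_sequence[OF t(1)]
      by (simp add: exp_growth_def abs_growth_le_iff)
    also have "\<dots> \<le> Sup (principal_cut ` exp_orders)"
      using t(1) by (intro Sup_upper) (auto simp: exp_orders_def)
    finally show "principal_cut (abs_growth (\<lambda>n. real (span_number M f \<epsilon> n)))
      \<le> Sup (principal_cut ` exp_orders)" .
  qed
qed

end
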